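(* Let $G$ be a locally compact, Hausdorff groupoid with totally disconnected unit space such that $s : G \to G^{(0)}$ is a local homeomorphism. Suppose that $\{u \in G^{(0)} : uGu = \{u\}\}$ is dense in $G^{(0)}$. Let $B$ be a complex algebra and let $\pi : A(G) \to B$ be a homomorphism. Suppose that $\ker(\pi) \neq \{0\}$. Then there is a nonempty compact open subset $K \subseteq G^{(0)}$ such that $\pi(1_K) = 0$.
   Context: A groupoid is a small category with inverses; a topological groupoid carries a topology making range $r$, source $s$, inversion and composition continuous. $G^{(0)}$ is the unit space; "totally disconnected" means it has a basis of clopen sets. For a unit $u$, $uGu:=\{\alpha\in G:r(\alpha)=s(\alpha)=u\}$ is the isotropy group at $u$. $A(G)$ is the set of locally constant functions in $C_c(G)$ (continuous compactly supported functions $G\to\mathbb{C}$), where locally constant means every point has a neighbourhood on which the function is constant. It is a complex algebra under $(f*g)(\gamma)=\sum_{r(\alpha)=r(\gamma)}f(\alpha)g(\alpha^{-1}\gamma)$. $1_K$ is the indicator function of $K$, regarded as a function on $G$ ($G^{(0)}$ is open in $G$). Algebras need not be unital; homomorphisms are $\mathbb{C}$-linear multiplicative maps. *)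

theory Defs
  imports "HOL-Analysis.Analysis"
begin

section \<open>Topological groupoids\<close>

text \<open>
  A small category is given by its arrows, with objects identified with their identity arrows,
  so that the unit space is a subset of the arrows.  The set of arrows is the carrier of the
  topology.  Composition \<open>gcomp G x y\<close> is only meaningful when \<open>src G x = rng G y\<close>.
\<close>

record 'a top_groupoid =
  gtop :: "'a topology"
  units :: "'a set"
  rng :: "'a \<Rightarrow> 'a"
  src :: "'a \<Rightarrow> 'a"
  gcomp :: "'a \<Rightarrow> 'a \<Rightarrow> 'a"
  ginv :: "'a \<Rightarrow> 'a"

definition arrows :: "'a top_groupoid \<Rightarrow> 'a set" where
  "arrows G = topspace (gtop G)"

definition composable :: "'a top_groupoid \<Rightarrow> ('a \<times> 'a) set" where
  "composable G = {(x, y). x \<in> arrows G \<and> y \<in> arrows G \<and> src G x = rng G y}"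

definition unit_space :: "'a top_groupoid \<Rightarrow> 'a topology" where
  "unit_space G = subtopology (gtop G) (units G)"

locale groupoid =
  fixes G :: "'a top_groupoid"
  assumes units_subset: "units G \<subseteq> arrows G"
    and rng_in: "x \<in> arrows G \<Longrightarrow> rng G x \<in> units G"
    and src_in: "x \<in> arrows G \<Longrightarrow> src G x \<in> units G"
    and rng_unit: "u \<in> units G \<Longrightarrow> rng G u = u"
    and src_unit: "u \<in> units G \<Longrightarrow> src G u = u"
    and comp_in: "(x, y) \<in> composable G \<Longrightarrow> gcomp G x y \<in> arrows G"
    and rng_comp: "(x, y) \<in> composable G \<Longrightarrow> rng G (gcomp G x y) = rng G x"
    and src_comp: "(x, y) \<in> composable G \<Longrightarrow> src G (gcomp G x y) = src G y"
    and comp_assoc: "(x, y) \<in> composable G \<Longrightarrow> (y, z) \<in> composable G \<Longrightarrow>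
           gcomp G (gcomp G x y) z = gcomp G x (gcomp G y z)"
    and comp_rng_left: "x \<in> arrows G \<Longrightarrow> gcomp G (rng G x) x = x"
    and comp_src_right: "x \<in> arrows G \<Longrightarrow> gcomp G x (src G x) = x"
    and inv_in: "x \<in> arrows G \<Longrightarrow> ginv G x \<in> arrows G"
    and rng_inv: "x \<in> arrows G \<Longrightarrow> rng G (ginv G x) = src G x"
    and src_inv: "x \<in> arrows G \<Longrightarrow> src G (ginv G x) = rng G x"
    and comp_inv_right: "x \<in> arrows G \<Longrightarrow> gcomp G x (ginv G x) = rng G x"
    and comp_inv_left: "x \<in> arrows G \<Longrightarrow> gcomp G (ginv G x) x = src G x"

locale topological_groupoid = groupoid G for G :: "'a top_groupoid" +
  assumes continuous_rng: "continuous_map (gtop G) (unit_space G) (rng G)"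
    and continuous_src: "continuous_map (gtop G) (unit_space G) (src G)"
    and continuous_inv: "continuous_map (gtop G) (gtop G) (ginv G)"
    and continuous_comp:
      "continuous_map (subtopology (prod_topology (gtop G) (gtop G)) (composable G)) (gtop G)
         (\<lambda>(x, y). gcomp G x y)"

definition isotropy :: "'a top_groupoid \<Rightarrow> 'a \<Rightarrow> 'a set" where
  "isotropy G u = {x \<in> arrows G. rng G x = u \<and> src G x = u}"

text \<open>Total disconnectedness in the sense of having a basis of clopen sets.\<close>

definition totally_disconnected_space :: "'a topology \<Rightarrow> bool" where
  "totally_disconnected_space X \<longleftrightarrow>
     (\<exists>\<B>. (\<forall>V \<in> \<B>. openin X V \<and> closedin X V) \<and>
          (\<forall>U x. openin X U \<and> x \<in> U \<longrightarrow> (\<exists>V \<in> \<B>. x \<in> V \<and> V \<subseteq> U)))"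

definition local_homeomorphism :: "'a topology \<Rightarrow> 'b topology \<Rightarrow> ('a \<Rightarrow> 'b) \<Rightarrow> bool" where
  "local_homeomorphism X Y f \<longleftrightarrow>
     (\<forall>x \<in> topspace X. \<exists>U. openin X U \<and> x \<in> U \<and> openin Y (f ` U) \<and>
        homeomorphic_map (subtopology X U) (subtopology Y (f ` U)) f)"

section \<open>The algebra of locally constant, compactly supported functions\<close>

definition locally_constant :: "'a topology \<Rightarrow> ('a \<Rightarrow> 'b) \<Rightarrow> bool" where
  "locally_constant X f \<longleftrightarrow>
     (\<forall>x \<in> topspace X. \<exists>V. openin X V \<and> x \<in> V \<and> f constant_on V)"

text \<open>
  Functions on a space \<open>X\<close> are represented by functions on the ambient type that vanish outside
  \<open>topspace X\<close>, so that equality on \<open>X\<close> is equality.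
\<close>

definition C_c :: "'a topology \<Rightarrow> ('a \<Rightarrow> complex) set" where
  "C_c X = {f. (\<forall>x. x \<notin> topspace X \<longrightarrow> f x = 0) \<and> continuous_map X euclidean f \<and>
     compactin X (X closure_of {x \<in> topspace X. f x \<noteq> 0})}"

definition steinberg_algebra :: "'a top_groupoid \<Rightarrow> ('a \<Rightarrow> complex) set" where
  "steinberg_algebra G = {f \<in> C_c (gtop G). locally_constant (gtop G) f}"

text \<open>
  The index set of the sum may be infinite; when range and source are local homeomorphisms and
  \<open>f\<close> is compactly supported, only finitely many terms are nonzero.
\<close>

definition convolution ::
  "'a top_groupoid \<Rightarrow> ('a \<Rightarrow> complex) \<Rightarrow> ('a \<Rightarrow> complex) \<Rightarrow> 'a \<Rightarrow> complex" where
  "convolution G f g = (\<lambda>z. if z \<in> arrows G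
     then \<Sum>\<^sub>\<infinity>x \<in> {x \<in> arrows G. rng G x = rng G z}. f x * g (gcomp G (ginv G x) z)
     else 0)"

text \<open>Complex algebras, not necessarily unital or commutative.\<close>

locale complex_algebra = vector_space sc
  for sc :: "complex \<Rightarrow> 'b::ring \<Rightarrow> 'b" +
  assumes scale_mult_left: "sc c x * y = sc c (x * y)"
    and scale_mult_right: "x * sc c y = sc c (x * y)"

definition steinberg_hom ::
  "'a top_groupoid \<Rightarrow> (complex \<Rightarrow> 'b::ring \<Rightarrow> 'b) \<Rightarrow> (('a \<Rightarrow> complex) \<Rightarrow> 'b) \<Rightarrow> bool" where
  "steinberg_hom G sc \<pi> \<longleftrightarrow>
     (\<forall>f \<in> steinberg_algebra G. \<forall>g \<in> steinberg_algebra G. \<pi> (\<lambda>x. f x + g x) = \<pi> f + \<pi> g) \<and>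
     (\<forall>c. \<forall>f \<in> steinberg_algebra G. \<pi> (\<lambda>x. c * f x) = sc c (\<pi> f)) \<and>
     (\<forall>f \<in> steinberg_algebra G. \<forall>g \<in> steinberg_algebra G. \<pi> (convolution G f g) = \<pi> f * \<pi> g)"

definition steinberg_kernel ::
  "'a top_groupoid \<Rightarrow> (('a \<Rightarrow> complex) \<Rightarrow> 'b::zero) \<Rightarrow> ('a \<Rightarrow> complex) set" where
  "steinberg_kernel G \<pi> = {f \<in> steinberg_algebra G. \<pi> f = 0}"

end

theory Submission
  imports Defs
begin

text \<open>
  Pick \<open>f \<noteq> 0\<close> in the kernel. On some open bisection \<open>W\<close> it is a nonzero constant \<open>c\<close>, and by
  density \<open>W\<close> contains an arrow \<open>\<gamma>\<close> whose source has trivial isotropy. Every arrow of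
  \<open>supp f - W\<close> then differs from \<open>\<gamma>\<close> in range or source, so by compactness there are compact open
  neighbourhoods \<open>L\<close> and \<open>M\<close> of \<open>r(\<gamma>)\<close> and \<open>s(\<gamma>)\<close> such that every arrow of \<open>supp f\<close> from \<open>M\<close> to \<open>L\<close>
  lies in \<open>W\<close>. Hence \<open>1\<^sub>L * f * 1\<^sub>M = c 1\<^sub>C\<close> for a compact open bisection \<open>C\<close>, and
  \<open>1\<^sub>K = 1\<^bsub>C\<^sup>-\<^sup>1\<^esub> * 1\<^sub>C\<close> with \<open>K = s(C)\<close> is in the kernel.
\<close>

section \<open>Locally constant functions\<close>

text \<open>Local constancy is continuity for the discrete topology on the codomain, so
  \<open>T\<close> may be arbitrary. The case of the singleton of 0 gives closed supports
  below.\<close>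

lemma locally_constant_openin_vimage:
  assumes "locally_constant X f"
  shows "openin X {x \<in> topspace X. f x \<in> T}"
proof (subst openin_subopen, intro ballI)
  fix x assume x: "x \<in> {x \<in> topspace X. f x \<in> T}"
  then obtain V where V: "openin X V" "x \<in> V" "f constant_on V"
    using assms unfolding locally_constant_def by auto
  have "V \<subseteq> {x \<in> topspace X. f x \<in> T}"
    using x V openin_subset[OF V(1)] by (auto simp: constant_on_def)
  with V show "\<exists>V. openin X V \<and> x \<in> V \<and> V \<subseteq> {x \<in> topspace X. f x \<in> T}"
    by blast
qed

lemma locally_constant_continuous_map:
  assumes "locally_constant X f"
  shows "continuous_map X euclidean f"
  using assms by (simp add: continuous_map locally_constant_openin_vimage)

lemma locally_constant_closedin_support:
  assumes "locally_constant X f"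
  shows "closedin X {x \<in> topspace X. f x \<noteq> 0}"
proof -
  have "topspace X - {x \<in> topspace X. f x \<noteq> 0} = {x \<in> topspace X. f x \<in> {0}}"
    by auto
  then show ?thesis
    using locally_constant_openin_vimage[OF assms, of "{0}"] by (simp add: closedin_def)
qed

text \<open>The nonvanishing set of a locally constant function is already closed, so compact
  support can be checked without taking a closure; continuity is automatic.\<close>

lemma steinberg_algebraI:
  assumes "Hausdorff_space (gtop G)"
    and "\<And>x. x \<notin> arrows G \<Longrightarrow> f x = 0"
    and "locally_constant (gtop G) f"
    and "compactin (gtop G) {x \<in> arrows G. f x \<noteq> 0}"
  shows "f \<in> steinberg_algebra G"
  using assms locally_constant_continuous_map[OF assms(3)]
    closure_of_closedin[OF locally_constant_closedin_support[OF assms(3)]]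
  by (auto simp: steinberg_algebra_def C_c_def arrows_def)

lemma steinberg_algebraD:
  assumes "f \<in> steinberg_algebra G"
  shows "x \<notin> arrows G \<Longrightarrow> f x = 0"
    and "locally_constant (gtop G) f"
    and "compactin (gtop G) {x \<in> arrows G. f x \<noteq> 0}"
proof -
  show lc: "locally_constant (gtop G) f"
    using assms by (simp add: steinberg_algebra_def)
  show "x \<notin> arrows G \<Longrightarrow> f x = 0"
    using assms by (auto simp: steinberg_algebra_def C_c_def arrows_def)
  show "compactin (gtop G) {x \<in> arrows G. f x \<noteq> 0}"
    using assms closure_of_closedin[OF locally_constant_closedin_support[OF lc]]
    by (auto simp: steinberg_algebra_def C_c_def arrows_def)
qed

text \<open>Openness of \<open>E\<close> handles points of \<open>E\<close>; closedness gives each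
  other point a neighbourhood on which the new function vanishes.\<close>

lemma locally_constant_restrict_clopen:
  assumes f: "locally_constant X f" and E: "openin X E" "closedin X E"
  shows "locally_constant X (\<lambda>x. if x \<in> E then f x else 0)"
  unfolding locally_constant_def
proof
  fix x assume x: "x \<in> topspace X"
  obtain V where V: "openin X V" "x \<in> V" "f constant_on V"
    using f x unfolding locally_constant_def by auto
  show "\<exists>V. openin X V \<and> x \<in> V \<and> (\<lambda>x. if x \<in> E then f x else 0) constant_on V"
  proof (cases "x \<in> E")
    case True
    then show ?thesis
      using V E by (intro exI[of _ "V \<inter> E"]) (auto simp: constant_on_def)
  next
    case False
    then show ?thesis
      using x E by (intro exI[of _ "topspace X - E"]) (auto simp: constant_on_def)
  qed
qed

lemma steinberg_algebra_restrict_clopen: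
  assumes H: "Hausdorff_space (gtop G)" and f: "f \<in> steinberg_algebra G"
    and E: "openin (gtop G) E" "closedin (gtop G) E"
  shows "(\<lambda>x. if x \<in> E then f x else 0) \<in> steinberg_algebra G"
proof (rule steinberg_algebraI[OF H])
  have "{x \<in> arrows G. (if x \<in> E then f x else 0) \<noteq> 0} = {x \<in> arrows G. f x \<noteq> 0} \<inter> E"
    by auto
  then show "compactin (gtop G) {x \<in> arrows G. (if x \<in> E then f x else 0) \<noteq> 0}"
    using steinberg_algebraD(3)[OF f] E(2) by (simp add: compact_Int_closedin)
qed (use f E in \<open>auto simp: steinberg_algebraD intro: locally_constant_restrict_clopen\<close>)

text \<open>A compact subset of a Hausdorff space is closed, so \<open>K\<close> is clopen and its
  indicator is the constant 1 cut down to a clopen set.\<close>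

lemma indicator_in_steinberg_algebra:
  assumes H: "Hausdorff_space (gtop G)" and K: "openin (gtop G) K" "compactin (gtop G) K"
  shows "indicator K \<in> steinberg_algebra G"
proof (rule steinberg_algebraI[OF H])
  have sub: "K \<subseteq> arrows G"
    using openin_subset[OF K(1)] by (simp add: arrows_def)
  have "locally_constant (gtop G) (\<lambda>x. 1 :: complex)"
    by (auto simp: locally_constant_def constant_on_def)
  moreover have "indicator K = (\<lambda>x. if x \<in> K then 1 else 0 :: complex)"
    by (auto simp: indicator_def)
  ultimately show "locally_constant (gtop G) (indicator K :: _ \<Rightarrow> complex)"
    using locally_constant_restrict_clopen K(1) compactin_imp_closedin[OF H K(2)] by simp
  have "{x \<in> arrows G. indicator K x \<noteq> (0 :: complex)} = K"
    using sub by (auto simp: indicator_def)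
  with K show "compactin (gtop G) {x \<in> arrows G. indicator K x \<noteq> (0 :: complex)}"
    by simp
  show "indicator K x = (0 :: complex)" if "x \<notin> arrows G" for x
    using that sub by (auto simp: indicator_def)
qed

section \<open>Convolution with indicator functions\<close>

text \<open>Discarding zero terms leaves at most one index, so no summability condition arises. Each
  convolution below collapses in this way.\<close>

lemma infsum_single:
  fixes f :: "'a \<Rightarrow> 'b::{comm_monoid_add, t2_space}"
  assumes "\<And>x. x \<noteq> i \<Longrightarrow> x \<in> A \<Longrightarrow> f x = 0"
  shows "infsum f A = (if i \<in> A then f i else 0)"
proof -
  have "infsum f A = infsum f (A \<inter> {i})"
    using assms by (intro infsum_cong_neutral) auto
  then show ?thesis
    by auto
qed

section \<open>Cancellation laws and convolution formulas in a groupoid\<close>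

context groupoid
begin

lemma ginv_unit:
  assumes "u \<in> units G"
  shows "ginv G u = u"
proof -
  have u: "u \<in> arrows G"
    using assms units_subset by auto
  have "ginv G u = gcomp G u (ginv G u)"
    using comp_rng_left[OF inv_in[OF u]] rng_inv[OF u] src_unit[OF assms] by simp
  also have "\<dots> = u"
    using comp_inv_right[OF u] rng_unit[OF assms] by simp
  finally show ?thesis .
qed

lemma comp_inv_cancel_left:
  assumes "x \<in> arrows G" "z \<in> arrows G" "rng G x = rng G z"
  shows "gcomp G x (gcomp G (ginv G x) z) = z"
  using comp_assoc[of x "ginv G x" z] assms
  by (auto simp: composable_def inv_in rng_inv src_inv comp_inv_right comp_rng_left)

lemma inv_comp_cancel_left:
  assumes "x \<in> arrows G" "z \<in> arrows G" "src G x = rng G z"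
  shows "gcomp G (ginv G x) (gcomp G x z) = z"
  using comp_assoc[of "ginv G x" x z] assms
  by (auto simp: composable_def inv_in rng_inv src_inv comp_inv_left comp_rng_left)

lemma ginv_ginv:
  assumes "x \<in> arrows G"
  shows "ginv G (ginv G x) = x"
proof -
  have "gcomp G x (gcomp G (ginv G x) (ginv G (ginv G x))) = ginv G (ginv G x)"
    using assms by (simp add: comp_inv_cancel_left inv_in rng_inv src_inv)
  then show ?thesis
    using assms by (simp add: comp_inv_right inv_in rng_inv comp_src_right)
qed

lemma ginv_comp_in:
  assumes "x \<in> arrows G" "z \<in> arrows G" "rng G x = rng G z"
  shows "gcomp G (ginv G x) z \<in> arrows G" "rng G (gcomp G (ginv G x) z) = src G x"
    "src G (gcomp G (ginv G x) z) = src G z"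
proof -
  have "(ginv G x, z) \<in> composable G"
    using assms by (auto simp: composable_def inv_in src_inv)
  from comp_in[OF this] rng_comp[OF this] src_comp[OF this] assms
  show "gcomp G (ginv G x) z \<in> arrows G" "rng G (gcomp G (ginv G x) z) = src G x"
    "src G (gcomp G (ginv G x) z) = src G z"
    by (auto simp: rng_inv)
qed

text \<open>A unit equals its own range, so the product must be s(x); multiplying by
  \<open>x\<close> on the left then gives both \<open>z\<close> and \<open>x\<close>.\<close>

lemma ginv_comp_unit_eq:
  assumes "x \<in> arrows G" "z \<in> arrows G" "rng G x = rng G z"
    and "gcomp G (ginv G x) z \<in> units G"
  shows "x = z"
proof -
  have "gcomp G (ginv G x) z = src G x"
    using ginv_comp_in(2)[OF assms(1-3)] rng_unit[OF assms(4)] by simp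
  then show ?thesis
    using comp_inv_cancel_left[OF assms(1-3)] comp_src_right[OF assms(1)] by simp
qed

text \<open>A nonzero term needs its index \<open>x\<close> in \<open>L\<close>, hence a unit, and a
  unit with the range of \<open>z\<close> is r(z) itself. Convolving by \<open>indicator L\<close>
  on the left is thus restriction by range.\<close>

lemma convolution_indicator_units_left:
  assumes L: "L \<subseteq> units G" and f: "\<And>x. x \<notin> arrows G \<Longrightarrow> f x = 0"
  shows "convolution G (indicator L) f = (\<lambda>z. if z \<in> {z \<in> arrows G. rng G z \<in> L} then f z else 0)"
proof
  fix z
  show "convolution G (indicator L) f z = (if z \<in> {z \<in> arrows G. rng G z \<in> L} then f z else 0)"
  proof (cases "z \<in> arrows G")
    case True
    let ?A = "{x \<in> arrows G. rng G x = rng G z}"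
    have "rng G z \<in> ?A"
      using True rng_in rng_unit units_subset by auto
    moreover have "(\<Sum>\<^sub>\<infinity>x\<in>?A. indicator L x * f (gcomp G (ginv G x) z)) =
        (if rng G z \<in> ?A then indicator L (rng G z) * f (gcomp G (ginv G (rng G z)) z) else 0)"
      by (rule infsum_single) (use L rng_unit in \<open>auto simp: indicator_def\<close>)
    ultimately show ?thesis
      using True by (simp add: convolution_def indicator_def ginv_unit rng_in comp_rng_left)
  qed (simp add: convolution_def)
qed

text \<open>A nonzero term needs the second factor evaluated at a unit, which forces the index to be
  \<open>z\<close>. Convolving on the right is thus restriction by source.\<close>

lemma convolution_indicator_units_right:
  assumes M: "M \<subseteq> units G"
  shows "convolution G f (indicator M) = (\<lambda>z. if z \<in> {z \<in> arrows G. src G z \<in> M} then f z else 0)"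
proof
  fix z
  show "convolution G f (indicator M) z = (if z \<in> {z \<in> arrows G. src G z \<in> M} then f z else 0)"
  proof (cases "z \<in> arrows G")
    case True
    let ?A = "{x \<in> arrows G. rng G x = rng G z}"
    have "(\<Sum>\<^sub>\<infinity>x\<in>?A. f x * indicator M (gcomp G (ginv G x) z)) =
        (if z \<in> ?A then f z * indicator M (gcomp G (ginv G z) z) else 0)"
      by (rule infsum_single) (use M True ginv_comp_unit_eq in \<open>auto simp: indicator_def\<close>)
    with True show ?thesis
      by (simp add: convolution_def indicator_def comp_inv_left)
  qed (simp add: convolution_def)
qed

text \<open>A nonzero term at \<open>z\<close> has index inverse to some \<open>c\<close> in
  \<open>C\<close> with the product cz in \<open>C\<close>. Since cz and c have the same range,
  injectivity of \<open>rng G\<close> gives cz = c, that is, z = s(c).\<close>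

lemma convolution_indicator_bisection:
  assumes C: "C \<subseteq> arrows G" and s: "inj_on (src G) C" and r: "inj_on (rng G) C"
  shows "convolution G (indicator (ginv G ` C)) (indicator C) = indicator (src G ` C)"
proof
  fix z
  show "convolution G (indicator (ginv G ` C)) (indicator C) z = indicator (src G ` C) z"
  proof (cases "z \<in> arrows G")
    case True
    let ?A = "{x \<in> arrows G. rng G x = rng G z}"
    let ?t = "\<lambda>x. indicator (ginv G ` C) x * indicator C (gcomp G (ginv G x) z) :: complex"
    have nz: "z = src G c" if c: "c \<in> C" "x = ginv G c" "x \<in> ?A" "gcomp G (ginv G x) z \<in> C" for x c
    proof -
      have ca: "c \<in> arrows G" "ginv G x = c" "rng G z = src G c"
        using c C ginv_ginv rng_inv by auto
      have "rng G (gcomp G (ginv G x) z) = rng G c"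
        using ginv_comp_in(2)[of x z] c True ca src_inv[OF ca(1)] by simp
      then have "gcomp G c z = c"
        using r c ca by (auto dest: inj_onD)
      then show ?thesis
        using inv_comp_cancel_left[OF ca(1) True] ca comp_inv_left by simp
    qed
    show ?thesis
    proof (cases "z \<in> src G ` C")
      case False
      have "infsum ?t ?A = 0"
        by (rule infsum_0) (use nz False in \<open>auto simp: indicator_def\<close>)
      with True False show ?thesis
        by (simp add: convolution_def)
    next
      case z: True
      then obtain c where c: "c \<in> C" "z = src G c"
        by auto
      then have ca: "c \<in> arrows G"
        using C by auto
      have cA: "ginv G c \<in> ?A"
        using c ca by (simp add: inv_in rng_inv rng_unit src_in)
      \<comment> \<open>Injectivity of \<open>src G\<close> on \<open>C\<close> makes
        \<open>c\<close> the only candidate, and its term is 1 because cz = c lies in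
        \<open>C\<close>.\<close>
      have "infsum ?t ?A = (if ginv G c \<in> ?A then ?t (ginv G c) else 0)"
      proof (rule infsum_single)
        fix x assume x: "x \<noteq> ginv G c" "x \<in> ?A"
        show "?t x = 0"
        proof (rule ccontr)
          assume "?t x \<noteq> 0"
          then obtain d where d: "d \<in> C" "x = ginv G d" "gcomp G (ginv G x) z \<in> C"
            by (auto simp: indicator_def split: if_splits)
          then have "src G d = src G c"
            using nz x c by metis
          then show False
            using s d c x by (auto dest: inj_onD)
        qed
      qed
      with cA c ca z True show ?thesis
        by (simp add: convolution_def indicator_def ginv_ginv comp_src_right)
    qed
  next
    case False
    then have "z \<notin> src G ` C"
      using C src_in units_subset by auto
    with False show ?thesis
      by (simp add: convolution_def)
  qed
qed

text \<open>Parallel arrows differ by an isotropy element at their common source; if that group is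
  trivial, the difference is a unit.\<close>

lemma trivial_isotropy_unique:
  assumes "x \<in> arrows G" "y \<in> arrows G" "rng G x = rng G y" "src G x = src G y"
    and "isotropy G (src G y) = {src G y}"
  shows "x = y"
proof (rule ginv_comp_unit_eq[OF assms(1-3)])
  have "gcomp G (ginv G x) y \<in> isotropy G (src G y)"
    using ginv_comp_in[OF assms(1-3)] assms(4) by (simp add: isotropy_def)
  with assms show "gcomp G (ginv G x) y \<in> units G"
    using src_in by auto
qed

end

section \<open>Etale groupoids\<close>

text \<open>Since the image of \<open>U\<close> is open in \<open>Y\<close>, sets open in that image
  are open in \<open>Y\<close>. Hence \<open>f\<close> is open on all open subsets of
  \<open>U\<close>, which allows later shrinking.\<close>

lemma local_homeomorphism_inj_open:
  assumes "local_homeomorphism X Y f" "x \<in> topspace X"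
  obtains U where "openin X U" "x \<in> U" "inj_on f U"
    and "\<And>V. openin X V \<Longrightarrow> V \<subseteq> U \<Longrightarrow> openin Y (f ` V)"
proof -
  from assms obtain U where U: "openin X U" "x \<in> U" "openin Y (f ` U)"
    and h: "homeomorphic_map (subtopology X U) (subtopology Y (f ` U)) f"
    unfolding local_homeomorphism_def by blast
  have "inj_on f U"
    using homeomorphic_imp_injective_map[OF h] openin_subset[OF U(1)]
    by (simp add: topspace_subtopology inf_absorb2)
  moreover have "openin Y (f ` V)" if V: "openin X V" "V \<subseteq> U" for V
  proof -
    have "openin (subtopology X U) V"
      using V by (simp add: openin_open_subtopology U)
    then have "openin (subtopology Y (f ` U)) (f ` V)"
      using homeomorphic_imp_open_map[OF h] by (auto simp: open_map_def)
    then show ?thesis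
      using U(3) openin_trans_full by blast
  qed
  ultimately show ?thesis
    using that U by blast
qed

locale etale_groupoid = topological_groupoid G for G :: "'a top_groupoid" +
  assumes src_local_homeomorphism: "local_homeomorphism (gtop G) (unit_space G) (src G)"
begin

lemma topspace_unit_space: "topspace (unit_space G) = units G"
  using units_subset by (auto simp: unit_space_def arrows_def)

text \<open>This lets open sets of units count as open sets of arrows, so that indicators of compact
  open sets of units lie in the algebra.\<close>

lemma openin_units: "openin (gtop G) (units G)"
proof (subst openin_subopen, intro ballI)
  fix u assume u: "u \<in> units G"
  then have "u \<in> topspace (gtop G)"
    using units_subset by (auto simp: arrows_def)
  then obtain U where U: "openin (gtop G) U" "u \<in> U" "inj_on (src G) U"
    using local_homeomorphism_inj_open[OF src_local_homeomorphism] by metis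
  let ?V = "U \<inter> {x \<in> topspace (gtop G). src G x \<in> units G \<inter> U}"
  have "openin (unit_space G) (units G \<inter> U)"
    using U(1) by (simp add: unit_space_def openin_subtopology_Int2)
  then have "openin (gtop G) ?V"
    using U(1) openin_continuous_map_preimage[OF continuous_src] by blast
  moreover have "u \<in> ?V"
    using u U \<open>u \<in> topspace (gtop G)\<close> src_unit by auto
  \<comment> \<open>An arrow of the bisection \<open>U\<close> whose source is in \<open>U\<close> has the same source as that unit.\<close>
  moreover have "?V \<subseteq> units G"
  proof
    fix x assume x: "x \<in> ?V"
    then have "src G (src G x) = src G x"
      by (simp add: src_unit)
    then have "src G x = x"
      using x U(3) by (auto dest: inj_onD)
    with x show "x \<in> units G"
      by auto
  qed
  ultimately show "\<exists>T. openin (gtop G) T \<and> u \<in> T \<and> T \<subseteq> units G"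
    by blast
qed

lemma openin_unit_space: "openin (unit_space G) K \<longleftrightarrow> openin (gtop G) K \<and> K \<subseteq> units G"
  unfolding unit_space_def by (rule openin_open_subtopology[OF openin_units])

lemma compactin_unit_space: "compactin (unit_space G) K \<longleftrightarrow> compactin (gtop G) K \<and> K \<subseteq> units G"
  by (simp add: unit_space_def compactin_subtopology)

text \<open>Inversion exchanges range and source, so injectivity of \<open>src G\<close> near the
  inverse of \<open>x\<close> becomes injectivity of \<open>rng G\<close> near \<open>x\<close>.
  Intersecting the two neighbourhoods yields a bisection.\<close>

lemma open_bisection:
  assumes x: "x \<in> arrows G"
  obtains U where "openin (gtop G) U" "x \<in> U" "inj_on (src G) U" "inj_on (rng G) U"
    and "\<And>V. openin (gtop G) V \<Longrightarrow> V \<subseteq> U \<Longrightarrow> openin (unit_space G) (src G ` V)"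
proof -
  obtain U where U: "openin (gtop G) U" "x \<in> U" "inj_on (src G) U"
    "\<And>V. openin (gtop G) V \<Longrightarrow> V \<subseteq> U \<Longrightarrow> openin (unit_space G) (src G ` V)"
    using local_homeomorphism_inj_open[OF src_local_homeomorphism, of x] x
    unfolding arrows_def by metis
  obtain U' where U': "openin (gtop G) U'" "ginv G x \<in> U'" "inj_on (src G) U'"
    using local_homeomorphism_inj_open[OF src_local_homeomorphism, of "ginv G x"] inv_in[OF x]
    unfolding arrows_def by metis
  let ?W = "U \<inter> {y \<in> topspace (gtop G). ginv G y \<in> U'}"
  have "openin (gtop G) ?W"
    using U(1) openin_continuous_map_preimage[OF continuous_inv U'(1)] by blast
  moreover have "x \<in> ?W"
    using x U U' by (simp add: arrows_def)
  moreover have "inj_on (src G) ?W"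
    using U(3) by (rule inj_on_subset) auto
  moreover have "inj_on (rng G) ?W"
  proof (rule inj_onI)
    fix y z assume yz: "y \<in> ?W" "z \<in> ?W" "rng G y = rng G z"
    then have "y \<in> arrows G" "z \<in> arrows G"
      by (auto simp: arrows_def)
    then have "src G (ginv G y) = src G (ginv G z)"
      using yz(3) by (simp add: src_inv)
    from inj_onD[OF U'(3) this] have "ginv G y = ginv G z"
      using yz(1,2) by simp
    then have "ginv G (ginv G y) = ginv G (ginv G z)"
      by simp
    with \<open>y \<in> arrows G\<close> \<open>z \<in> arrows G\<close> show "y = z"
      by (simp add: ginv_ginv)
  qed
  moreover have "openin (unit_space G) (src G ` V)" if "openin (gtop G) V" "V \<subseteq> ?W" for V
    using that U(4) by auto
  ultimately show ?thesis
    using that by blast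
qed

text \<open>A clopen set chosen inside a compact set is closed in it and therefore compact; local
  compactness supplies the compact set.\<close>

lemma compact_open_unit_neighbourhood:
  assumes lc: "locally_compact_space (gtop G)" and H: "Hausdorff_space (gtop G)"
    and td: "totally_disconnected_space (unit_space G)"
    and N: "openin (unit_space G) N" "u \<in> N"
  obtains K where "openin (unit_space G) K" "compactin (unit_space G) K" "u \<in> K" "K \<subseteq> N"
proof -
  have "locally_compact_space (unit_space G)"
    unfolding unit_space_def using lc H openin_units
    by (simp add: locally_compact_space_open_subset)
  moreover have "u \<in> topspace (unit_space G)"
    using N openin_subset by blast
  ultimately obtain U F where U: "openin (unit_space G) U" "compactin (unit_space G) F" "u \<in> U" "U \<subseteq> F"
    unfolding locally_compact_space_def by blast
  obtain \<B> where "\<forall>V \<in> \<B>. openin (unit_space G) V \<and> closedin (unit_space G) V"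
    and "\<forall>U x. openin (unit_space G) U \<and> x \<in> U \<longrightarrow> (\<exists>V \<in> \<B>. x \<in> V \<and> V \<subseteq> U)"
    using td unfolding totally_disconnected_space_def by blast
  moreover have "openin (unit_space G) (U \<inter> N) \<and> u \<in> U \<inter> N"
    using U N by auto
  ultimately obtain K where K: "openin (unit_space G) K" "closedin (unit_space G) K" "u \<in> K" "K \<subseteq> U \<inter> N"
    by metis
  moreover have "compactin (unit_space G) K"
    using closed_compactin[OF U(2) _ K(2)] K(4) U(4) by blast
  ultimately show ?thesis
    using that by blast
qed

text \<open>
  The compact image of \<open>D\<close> in the product of the unit space with itself is closed, so a box around
  \<open>(u, v)\<close> misses it.
\<close>

lemma separating_unit_neighbourhoods:
  assumes lc: "locally_compact_space (gtop G)" and H: "Hausdorff_space (gtop G)"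
    and td: "totally_disconnected_space (unit_space G)"
    and D: "compactin (gtop G) D" and uv: "u \<in> units G" "v \<in> units G"
    and sep: "\<And>x. x \<in> D \<Longrightarrow> rng G x \<noteq> u \<or> src G x \<noteq> v"
  obtains L M where "openin (unit_space G) L" "compactin (unit_space G) L" "u \<in> L"
    and "openin (unit_space G) M" "compactin (unit_space G) M" "v \<in> M"
    and "\<forall>x \<in> D. rng G x \<notin> L \<or> src G x \<notin> M"
proof -
  let ?Y = "prod_topology (unit_space G) (unit_space G)"
  let ?h = "\<lambda>x. (rng G x, src G x)"
  have "continuous_map (gtop G) ?Y ?h"
    using continuous_rng continuous_src by (simp add: continuous_map_pairedI)
  then have "compactin ?Y (?h ` D)"
    using D image_compactin by blast
  moreover have "Hausdorff_space ?Y"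
    using H unfolding unit_space_def
    by (simp add: Hausdorff_space_prod_topology Hausdorff_space_subtopology)
  ultimately have "openin ?Y (topspace ?Y - ?h ` D)"
    using compactin_imp_closedin openin_diff openin_topspace by blast
  moreover have "(u, v) \<in> topspace ?Y - ?h ` D"
    using sep uv by (auto simp: topspace_unit_space)
  ultimately have "\<exists>L M. openin (unit_space G) L \<and> openin (unit_space G) M \<and> u \<in> L \<and> v \<in> M \<and>
      L \<times> M \<subseteq> topspace ?Y - ?h ` D"
    by (simp only: openin_prod_topology_alt)
  then obtain L0 M0 where L0: "openin (unit_space G) L0" "u \<in> L0"
    and M0: "openin (unit_space G) M0" "v \<in> M0" and sub: "L0 \<times> M0 \<subseteq> topspace ?Y - ?h ` D"
    by blast
  \<comment> \<open>Shrinking the sides of the box to compact open sets keeps it disjoint from the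
    image of \<open>D\<close>.\<close>
  obtain L where L: "openin (unit_space G) L" "compactin (unit_space G) L" "u \<in> L" "L \<subseteq> L0"
    by (rule compact_open_unit_neighbourhood[OF lc H td L0])
  obtain M where M: "openin (unit_space G) M" "compactin (unit_space G) M" "v \<in> M" "M \<subseteq> M0"
    by (rule compact_open_unit_neighbourhood[OF lc H td M0])
  have "\<forall>x \<in> D. rng G x \<notin> L \<or> src G x \<notin> M"
    using sub L(4) M(4) by blast
  then show ?thesis
    by (rule that[OF L(1-3) M(1-3)])
qed

text \<open>The topological core. \<open>C\<close> is given by range and source conditions on the
  support of \<open>f\<close> so that it matches what two-sided convolution with
  \<open>indicator L\<close> and \<open>indicator M\<close> leaves of \<open>f\<close>.\<close>

lemma exists_isolating_bisection:
  assumes lc: "locally_compact_space (gtop G)" and H: "Hausdorff_space (gtop G)"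
    and td: "totally_disconnected_space (unit_space G)"
    and dense: "unit_space G closure_of {u \<in> units G. isotropy G u = {u}} = units G"
    and f: "f \<in> steinberg_algebra G" "f \<noteq> (\<lambda>x. 0)"
  obtains L M C c where "openin (unit_space G) L" "compactin (unit_space G) L"
    and "openin (unit_space G) M" "compactin (unit_space G) M"
    and "C = {x \<in> arrows G. f x \<noteq> 0 \<and> rng G x \<in> L \<and> src G x \<in> M}" "C \<noteq> {}"
    and "openin (gtop G) C" "compactin (gtop G) C"
    and "inj_on (src G) C" "inj_on (rng G) C" "openin (unit_space G) (src G ` C)"
    and "c \<noteq> 0" "\<forall>x \<in> C. f x = c"
proof -
  let ?S = "{x \<in> arrows G. f x \<noteq> 0}"
  obtain g where g: "f g \<noteq> 0"
    using f(2) by auto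
  then have ga: "g \<in> arrows G"
    using steinberg_algebraD(1)[OF f(1)] by auto
  obtain V where V: "openin (gtop G) V" "g \<in> V" "f constant_on V"
    using steinberg_algebraD(2)[OF f(1)] ga unfolding locally_constant_def arrows_def by blast
  obtain U where U: "openin (gtop G) U" "g \<in> U" "inj_on (src G) U" "inj_on (rng G) U"
    and Uo: "\<And>V. openin (gtop G) V \<Longrightarrow> V \<subseteq> U \<Longrightarrow> openin (unit_space G) (src G ` V)"
    using open_bisection[OF ga] by metis
  let ?W = "U \<inter> V"
  have W: "openin (gtop G) ?W" "?W \<subseteq> arrows G"
    using U V openin_subset[OF U(1)] by (auto simp: arrows_def)
  have fW: "f x = f g" if "x \<in> ?W" for x
    using that V by (auto simp: constant_on_def)
  \<comment> \<open>The source image of \<open>?W\<close> is open and contains s(g), so it meets the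
    dense set of units with trivial isotropy; \<open>y\<close> is an arrow of \<open>?W\<close> over
    such a unit.\<close>
  have "openin (unit_space G) (src G ` ?W)"
    using Uo W by blast
  moreover have "src G g \<in> unit_space G closure_of {u \<in> units G. isotropy G u = {u}}"
    using dense ga src_in by simp
  moreover have "src G g \<in> src G ` ?W"
    using U V by blast
  ultimately have "\<exists>u. u \<in> {u \<in> units G. isotropy G u = {u}} \<and> u \<in> src G ` ?W"
    by (meson in_closure_of)
  then obtain y where y: "y \<in> ?W" "isotropy G (src G y) = {src G y}"
    by blast
  then have ya: "y \<in> arrows G"
    using W by blast
  have D: "compactin (gtop G) (?S - ?W)"
    using closed_Int_compactin[OF closedin_diff[OF closedin_topspace W(1)]
        steinberg_algebraD(3)[OF f(1)]]
    by (rule back_subst) (auto simp: arrows_def)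
  \<comment> \<open>An arrow parallel to \<open>y\<close> equals \<open>y\<close>, which lies in
    \<open>?W\<close>.\<close>
  have sep: "rng G x \<noteq> rng G y \<or> src G x \<noteq> src G y" if "x \<in> ?S - ?W" for x
    using that trivial_isotropy_unique[OF _ ya _ _ y(2)] y(1) by blast
  obtain L M where L: "openin (unit_space G) L" "compactin (unit_space G) L" "rng G y \<in> L"
    and M: "openin (unit_space G) M" "compactin (unit_space G) M" "src G y \<in> M"
    and LM: "\<forall>x \<in> ?S - ?W. rng G x \<notin> L \<or> src G x \<notin> M"
    by (rule separating_unit_neighbourhoods[OF lc H td D rng_in[OF ya] src_in[OF ya] sep])
  let ?C = "{x \<in> arrows G. f x \<noteq> 0 \<and> rng G x \<in> L \<and> src G x \<in> M}"
  let ?E = "{x \<in> topspace (gtop G). rng G x \<in> L} \<inter> {x \<in> topspace (gtop G). src G x \<in> M}"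
  have HU: "Hausdorff_space (unit_space G)"
    using H by (simp add: unit_space_def Hausdorff_space_subtopology)
  have CW: "?C \<subseteq> ?W"
    using LM by blast
  \<comment> \<open>Two descriptions of \<open>?C\<close> with the clopen set \<open>?E\<close> are
    used. Intersecting with \<open>?W\<close>, where \<open>f\<close> has the nonzero value
    \<open>f g\<close>, shows openness; intersecting with the support \<open>?S\<close> shows
    compactness.\<close>
  have "?C = ?W \<inter> ?E"
    using CW W(2) fW g by (auto simp: arrows_def)
  moreover have "openin (gtop G) ?E"
    using openin_continuous_map_preimage[OF continuous_rng L(1)]
      openin_continuous_map_preimage[OF continuous_src M(1)] by (rule openin_Int)
  ultimately have Co: "openin (gtop G) ?C"
    using W(1) by (simp only: openin_Int)
  have "closedin (gtop G) ?E"
    using closedin_continuous_map_preimage[OF continuous_rng compactin_imp_closedin[OF HU L(2)]]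
      closedin_continuous_map_preimage[OF continuous_src compactin_imp_closedin[OF HU M(2)]]
    by (rule closedin_Int)
  moreover have "?C = ?S \<inter> ?E"
    by (auto simp: arrows_def)
  ultimately have Cc: "compactin (gtop G) ?C"
    using steinberg_algebraD(3)[OF f(1)] by (simp only: compact_Int_closedin)
  have "y \<in> ?C"
    using y ya fW g L M by auto
  then have ne: "?C \<noteq> {}"
    by blast
  have "?C \<subseteq> U"
    using CW by blast
  then have inj: "inj_on (src G) ?C" "inj_on (rng G) ?C"
    using U(3,4) inj_on_subset by blast+
  have "openin (unit_space G) (src G ` ?C)"
    using Uo[OF Co \<open>?C \<subseteq> U\<close>] .
  moreover have "\<forall>x \<in> ?C. f x = f g"
    using CW fW by blast
  ultimately show ?thesis
    by (rule that[OF L(1,2) M(1,2) refl ne Co Cc inj _ g])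
qed

end

section \<open>From a nonzero kernel element to an indicator function in the kernel\<close>

lemma steinberg_hom_zero:
  assumes "complex_algebra sc" "steinberg_hom G sc \<pi>" "f \<in> steinberg_algebra G"
  shows "\<pi> (\<lambda>x. 0) = 0"
proof -
  interpret complex_algebra sc by fact
  have "\<pi> (\<lambda>x. 0 * f x) = sc 0 (\<pi> f)"
    using assms unfolding steinberg_hom_def by blast
  then show ?thesis
    by simp
qed

theorem theorem5p2:
  fixes G :: "'a top_groupoid"
    and sc :: "complex \<Rightarrow> 'b::ring \<Rightarrow> 'b"
    and \<pi> :: "('a \<Rightarrow> complex) \<Rightarrow> 'b"
  assumes "topological_groupoid G"
    and "locally_compact_space (gtop G)"
    and "Hausdorff_space (gtop G)"
    and "totally_disconnected_space (unit_space G)"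
    and "local_homeomorphism (gtop G) (unit_space G) (src G)"
    and "unit_space G closure_of {u \<in> units G. isotropy G u = {u}} = units G"
    and "complex_algebra sc"
    and "steinberg_hom G sc \<pi>"
    and "steinberg_kernel G \<pi> \<noteq> {\<lambda>x. 0}"
  shows "\<exists>K. K \<noteq> {} \<and> openin (unit_space G) K \<and> compactin (unit_space G) K \<and>
           \<pi> (indicator K) = 0"
proof -
  interpret etale_groupoid G
    using assms(1,5) by (simp add: etale_groupoid_def etale_groupoid_axioms_def)
  interpret complex_algebra sc by fact
  note H = assms(3) and hom = assms(8)
  have mult: "\<pi> (convolution G f g) = \<pi> f * \<pi> g"
    if "f \<in> steinberg_algebra G" "g \<in> steinberg_algebra G" for f g
    using hom that unfolding steinberg_hom_def by blast
  have scale: "\<pi> (\<lambda>x. c * f x) = sc c (\<pi> f)" if "f \<in> steinberg_algebra G" for c f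
    using hom that unfolding steinberg_hom_def by blast
  have ind: "indicator K \<in> steinberg_algebra G"
    if "openin (unit_space G) K" "compactin (unit_space G) K" for K
    using that indicator_in_steinberg_algebra[OF H]
    by (simp add: openin_unit_space compactin_unit_space)
  \<comment> \<open>The hypothesis only says that the kernel differs from the set containing the
    zero function alone. Membership of zero rules out an empty kernel, so a nonzero element
    exists.\<close>
  have "(indicator {} :: 'a \<Rightarrow> complex) = (\<lambda>x. 0)"
    by (auto simp: indicator_def)
  then have "(\<lambda>x. 0) \<in> steinberg_algebra G"
    using ind[of "{}"] by simp
  then have "(\<lambda>x. 0) \<in> steinberg_kernel G \<pi>"
    using steinberg_hom_zero[OF assms(7) hom]
    by (simp add: steinberg_kernel_def)
  then obtain f where f: "f \<in> steinberg_algebra G" "f \<noteq> (\<lambda>x. 0)" "\<pi> f = 0"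
    using assms(9) unfolding steinberg_kernel_def by blast
  obtain L M C c where L: "openin (unit_space G) L" "compactin (unit_space G) L"
    and M: "openin (unit_space G) M" "compactin (unit_space G) M"
    and C: "C = {x \<in> arrows G. f x \<noteq> 0 \<and> rng G x \<in> L \<and> src G x \<in> M}" "C \<noteq> {}"
    and Co: "openin (gtop G) C" and Cc: "compactin (gtop G) C"
    and bis: "inj_on (src G) C" "inj_on (rng G) C" and Ko: "openin (unit_space G) (src G ` C)"
    and c: "c \<noteq> 0" "\<forall>x \<in> C. f x = c"
    by (rule exists_isolating_bisection[OF assms(2-4,6) f(1,2)])
  have sub: "C \<subseteq> arrows G"
    using C by blast
  have Ka: "compactin (unit_space G) (src G ` C)"
    using image_compactin[OF Cc continuous_src] .
  have Csa: "indicator C \<in> steinberg_algebra G"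
    using indicator_in_steinberg_algebra[OF H Co Cc] .

  \<comment> \<open>Multiplicativity of \<open>\<pi>\<close> is available only inside the algebra,
    so the intermediate product must be shown to lie there. It is \<open>f\<close> restricted to the
    clopen set \<open>?E\<close>.\<close>
  let ?E = "{x \<in> arrows G. rng G x \<in> L}"
  have HU: "Hausdorff_space (unit_space G)"
    using H by (simp add: unit_space_def Hausdorff_space_subtopology)
  have E: "openin (gtop G) ?E" "closedin (gtop G) ?E"
    unfolding arrows_def
    using openin_continuous_map_preimage[OF continuous_rng L(1)]
      closedin_continuous_map_preimage[OF continuous_rng compactin_imp_closedin[OF HU L(2)]] by auto
  have Lf: "convolution G (indicator L) f = (\<lambda>z. if z \<in> ?E then f z else 0)"
    using convolution_indicator_units_left L(1) steinberg_algebraD(1)[OF f(1)]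
    by (simp add: openin_unit_space)
  then have "convolution G (indicator L) f \<in> steinberg_algebra G"
    using steinberg_algebra_restrict_clopen[OF H f(1) E] by simp
  moreover have "\<pi> (convolution G (indicator L) f) = 0"
    using mult[OF ind[OF L] f(1)] f(3) by simp
  ultimately have "\<pi> (convolution G (convolution G (indicator L) f) (indicator M)) = 0"
    using mult[OF _ ind[OF M]] by simp
  \<comment> \<open>Restricting by range in \<open>L\<close> and source in \<open>M\<close> leaves
    exactly the values of \<open>f\<close> on \<open>C\<close>, all equal to \<open>c\<close>; since
    \<open>c\<close> is nonzero, the scalar can then be removed.\<close>
  moreover have "convolution G (convolution G (indicator L) f) (indicator M) = (\<lambda>x. c * indicator C x)"
  proof
    fix z
    have "convolution G (convolution G (indicator L) f) (indicator M) z =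
        (if z \<in> {z \<in> arrows G. src G z \<in> M} then (if z \<in> ?E then f z else 0) else 0)"
      using convolution_indicator_units_right M(1) unfolding Lf by (simp add: openin_unit_space)
    also have "\<dots> = c * indicator C z"
      using c(2) by (auto simp: C(1) indicator_def)
    finally show "convolution G (convolution G (indicator L) f) (indicator M) z = c * indicator C z" .
  qed
  ultimately have "sc c (\<pi> (indicator C)) = 0"
    using scale[OF Csa, of c] by simp
  then have piC: "\<pi> (indicator C) = 0"
    using c(1) by simp

  \<comment> \<open>Inversion is an involution, so the image of \<open>C\<close> is also a preimage:
    openness comes from the preimage form, compactness from the image form.\<close>
  have "ginv G ` C = {x \<in> topspace (gtop G). ginv G x \<in> C}"
    using sub inv_in ginv_ginv by (force simp: arrows_def)
  then have "openin (gtop G) (ginv G ` C)"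
    using openin_continuous_map_preimage[OF continuous_inv Co] by simp
  moreover have "compactin (gtop G) (ginv G ` C)"
    using image_compactin[OF Cc continuous_inv] .
  ultimately have "\<pi> (convolution G (indicator (ginv G ` C)) (indicator C)) = 0"
    using mult[OF indicator_in_steinberg_algebra[OF H] Csa] piC by simp
  \<comment> \<open>The product of the two bisection indicators is the indicator of s(C), which is
    the required set and is nonempty because \<open>C\<close> is.\<close>
  then have "\<pi> (indicator (src G ` C)) = 0"
    by (simp add: convolution_indicator_bisection[OF sub bis])
  with C(2) Ko Ka show ?thesis
    by (intro exI[of _ "src G ` C"]) simp
qed

end
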